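(* Assume that the potential $V$ is quadratic with a positive definite Hessian $\bm{H}:=D^2V$. Let $\lambda$ be the largest eigenvalue of $\bm{H}$. Let $\mu>0$ be the smallest eigenvalue of $\bm{M}$. Then the scheme described in the context is conditionally stable for a constant time-step $h$ under the following CFL condition: $$h<2\sqrt{\frac{\mu}{\lambda}}.$$
   Context: Let $d,N\ge 1$ be integers, let $\bm{M}\in\mathbb{R}^{dN\times dN}$ be a symmetric positive definite (mass) matrix and let $V:\mathbb{R}^{dN}\to\mathbb{R}$ be a potential energy. The Hamiltonian system to be integrated is $\dot{\bm{q}}=\bm{M}^{-1}\bm{p}$, $\dot{\bm{p}}=-\nabla V(\bm{q})$, with given initial values $\bm{q}(t^0),\bm{p}(t^0)\in\mathbb{R}^{dN}$. Scheme. With time nodes $t^n$, $n=0,1,\dots$, constant time-step $h=t^{n+1}-t^n>0$ and $I_n=[t^n,t^{n+1}]$, knowing $\bm{p}^{n-1/2},\bm{q}^n,[\bm{p}]^n\in\mathbb{R}^{dN}$ (where $[\bm{p}]^n$ is the momentum jump at $t^n$), one computes $$\bm{p}^{n+1/2}=\bm{p}^{n-1/2}+[\bm{p}]^n,\qquad \bm{q}^{n+1}=\bm{q}^n+h\bm{M}^{-1}\bm{p}^{n+1/2},\qquad \tfrac12\left([\bm{p}]^{n+1}+[\bm{p}]^n\right)=-\int_{I_n}\nabla V(\hat{\bm{q}}^n(t))\,dt,$$ with the free-flight trajectory $\hat{\bm{q}}^n(t)=\bm{q}^n+(t-t^n)\bm{M}^{-1}\bm{p}^{n+1/2}$ for $t\in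 I_n$. The initialization is $\bm{p}^{-1/2}=\bm{p}(t^0)$, $\bm{q}^0=\bm{q}(t^0)$, $[\bm{p}]^0=\bm{0}$. Meaning of stability. The stability is linear stability: since adding a linear functional to $V$ does not change the nature of the Hamiltonian system, one considers $V(\bm{0})=0$ and $\nabla V(\bm{0})=\bm{0}$, and, setting $\bm{Z}^n=(\bm{q}^n,\bm{p}^{n-1/2},\bm{p}^{n+1/2})\in(\mathbb{R}^{dN})^3$, stability means that $\|\bm{Z}^n\|\le C\|\bm{Z}^0\|$ for all $n\in\mathbb{N}$, with a constant $C$ independent of $n$. *)

theory Defs
  imports "HOL-Analysis.Analysis"
begin

definition sym_pos_def :: "real^'n^'n \<Rightarrow> bool" where
  "sym_pos_def A \<longleftrightarrow> transpose A = A \<and> (\<forall>v. v \<noteq> 0 \<longrightarrow> v \<bullet> (A *v v) > 0)"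

definition eigenvalue :: "real^'n^'n \<Rightarrow> real \<Rightarrow> bool" where
  "eigenvalue A l \<longleftrightarrow> (\<exists>v. v \<noteq> 0 \<and> A *v v = l *\<^sub>R v)"

definition is_largest_eigenvalue :: "real^'n^'n \<Rightarrow> real \<Rightarrow> bool" where
  "is_largest_eigenvalue A l \<longleftrightarrow> eigenvalue A l \<and> (\<forall>k. eigenvalue A k \<longrightarrow> k \<le> l)"

definition is_smallest_eigenvalue :: "real^'n^'n \<Rightarrow> real \<Rightarrow> bool" where
  "is_smallest_eigenvalue A l \<longleftrightarrow> eigenvalue A l \<and> (\<forall>k. eigenvalue A k \<longrightarrow> l \<le> k)"

(* The gradient and the Hessian are meaningful only where V is (twice) differentiable. *)
definition gradient :: "(real^'n \<Rightarrow> real) \<Rightarrow> real^'n \<Rightarrow> real^'n" where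
  "gradient V x = (THE g. GDERIV V x :> g)"

definition hessian :: "(real^'n \<Rightarrow> real) \<Rightarrow> real^'n \<Rightarrow> real^'n^'n" where
  "hessian V x = jacobian (gradient V) (at x)"

(* Polynomial functions of degree at most two. *)
definition quadratic :: "(real^'n \<Rightarrow> real) \<Rightarrow> bool" where
  "quadratic V \<longleftrightarrow> (\<exists>A b c. \<forall>x. V x = x \<bullet> (A *v x) + b \<bullet> x + c)"

definition free_flight ::
  "real^'n^'n \<Rightarrow> real \<Rightarrow> real^'n \<Rightarrow> real^'n \<Rightarrow> real \<Rightarrow> real^'n" where
  "free_flight M s x p r = x + (r - s) *\<^sub>R (matrix_inv M *v p)"

(* Index shift for the half-integer momenta: p n stands for p^(n-1/2), so that p 0 = p^(-1/2)
   and p (Suc n) = p^(n+1/2). J n is the momentum jump [p]^n, and t n is the n-th time node;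
   q0 and p0 are the initial position and momentum at time t 0. *)
definition scheme ::
  "real^'n^'n \<Rightarrow> (real^'n \<Rightarrow> real) \<Rightarrow> real \<Rightarrow> (nat \<Rightarrow> real) \<Rightarrow> real^'n \<Rightarrow> real^'n \<Rightarrow>
   (nat \<Rightarrow> real^'n) \<Rightarrow> (nat \<Rightarrow> real^'n) \<Rightarrow> (nat \<Rightarrow> real^'n) \<Rightarrow> bool" where
  "scheme M V h t q0 p0 q p J \<longleftrightarrow>
     p 0 = p0 \<and> q 0 = q0 \<and> J 0 = 0 \<and>
     (\<forall>n. p (Suc n) = p n + J n \<and>
          q (Suc n) = q n + h *\<^sub>R (matrix_inv M *v p (Suc n)) \<and>
          (1/2) *\<^sub>R (J (Suc n) + J n) =
            - integral {t n..t (Suc n)}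
                (\<lambda>s. gradient V (free_flight M (t n) (q n) (p (Suc n)) s)))"

(* The triple below is Z^n = (q^n, p^(n-1/2), p^(n+1/2)). The constant C is uniform in the
   step n and in the initial data. *)
definition linearly_stable ::
  "real^'n^'n \<Rightarrow> (real^'n \<Rightarrow> real) \<Rightarrow> real \<Rightarrow> (nat \<Rightarrow> real) \<Rightarrow> bool" where
  "linearly_stable M V h t \<longleftrightarrow>
     (\<exists>C. \<forall>q0 p0 q p J. scheme M V h t q0 p0 q p J \<longrightarrow>
        (\<forall>n. norm (q n, p n, p (Suc n)) \<le> C * norm (q 0, p 0, p (Suc 0))))"

end

theory Submission
  imports Defs
begin

text \<open>
  Write \<open>W = M\<^sup>-\<^sup>1\<close>. For a quadratic potential the force integral along a free flight is
  given exactly by the trapezoidal rule, so two consecutive jumps add up to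
  \<open>- h H (q\<^sub>n + q\<^sub>n\<^sub>+\<^sub>1)\<close>, which is the momentum increment
  over two consecutive steps. Therefore the mixed energy
  \<open>E\<^sub>n = q\<^sub>n \<bullet> H q\<^sub>n + p\<^sub>n \<bullet> W p\<^sub>n\<^sub>+\<^sub>1\<close>
  is conserved exactly (\<open>scheme_energy_conserved\<close>).

  This energy is not obviously bounded below, because its kinetic part pairs two different
  momenta. With the mean momentum \<open>m = (p\<^sub>n + p\<^sub>n\<^sub>+\<^sub>1) / 2\<close> and the jump
  \<open>J\<^sub>n = p\<^sub>n\<^sub>+\<^sub>1 - p\<^sub>n\<close> it is
  \<open>q\<^sub>n \<bullet> H q\<^sub>n + m \<bullet> W m - J\<^sub>n \<bullet> W J\<^sub>n / 4\<close>.
  The recursion for the jumps, started from a zero jump, has the closed solution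
  \<open>J\<^sub>n = - h H (q\<^sub>n - y)\<close> with \<open>y = (-1)\<^sup>n q\<^sub>0\<close> (\<open>scheme_jump\<close>).
  Since \<open>W \<le> 1 / mu\<close> and \<open>H\<^sup>2 \<le> lam H\<close>, the negative term is at most
  \<open>th\<close> times the \<open>H\<close>-form of \<open>q\<^sub>n - y\<close>, where
  \<open>th = h\<^sup>2 lam / (4 mu)\<close>. The CFL condition says precisely \<open>th < 1\<close>. Hence
  the potential part absorbs the negative term up to a multiple of the \<open>H\<close>-form of
  \<open>q\<^sub>0\<close> (\<open>perturbed_form_lower_bound\<close>). Conservation then bounds \<open>q\<^sub>n\<close> and \<open>m\<close>,
  the closed form bounds \<open>J\<^sub>n\<close>, and the two momenta are \<open>m - J\<^sub>n / 2\<close> and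
  \<open>m + J\<^sub>n / 2\<close>.

  The only spectral fact involved is that the extreme values of the Rayleigh quotient of a
  symmetric matrix are eigenvalues (\<open>symmetric_rayleigh_minimum\<close>).
\<close>

section \<open>Quadratic forms and extreme eigenvalues\<close>

lemma symmetric_matrix_inner:
  fixes A :: "real^'n^'n"
  assumes "transpose A = A"
  shows "x \<bullet> (A *v y) = (A *v x) \<bullet> y"
  using assms by (metis dot_lmul_matrix transpose_matrix_vector)

text \<open>
  The form is nonnegative on the line \<open>x - s y\<close>, a polynomial in \<open>s\<close> of degree at most two, so
  its discriminant is not positive. Allowing semidefinite forms is essential: for them the
  inequality shows that a vector on which the form vanishes lies in the kernel of the matrix.
\<close>

lemma psd_cauchy_schwarz:
  fixes A :: "real^'n^'n"
  assumes sym: "transpose A = A" and psd: "\<And>v. 0 \<le> v \<bullet> (A *v v)"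
  shows "(x \<bullet> (A *v y))\<^sup>2 \<le> (x \<bullet> (A *v x)) * (y \<bullet> (A *v y))"
proof -
  define a b c where "a = x \<bullet> (A *v x)" and "b = x \<bullet> (A *v y)" and "c = y \<bullet> (A *v y)"
  have poly: "0 \<le> a - 2 * s * b + s\<^sup>2 * c" for s
  proof -
    have "y \<bullet> (A *v x) = b"
      using symmetric_matrix_inner[OF sym, of y x] by (simp add: b_def inner_commute)
    then have "(x - s *\<^sub>R y) \<bullet> (A *v (x - s *\<^sub>R y)) = a - 2 * s * b + s\<^sup>2 * c"
      by (simp add: a_def b_def c_def matrix_vector_mult_diff_distrib inner_diff_left
          inner_diff_right matrix_vector_mult_scaleR power2_eq_square algebra_simps)
    then show ?thesis using psd[of "x - s *\<^sub>R y"] by simp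
  qed
  have "b\<^sup>2 \<le> a * c"
  proof (cases "c = 0")
    case True
    have "b = 0"
    proof (rule ccontr)
      assume "b \<noteq> 0"
      \<comment> \<open>The polynomial is now affine in \<open>s\<close>; at this point it takes the value \<open>-1\<close>.\<close>
      then show False using poly[of "(a + 1) / (2 * b)"] True by simp
    qed
    then show ?thesis using True by simp
  next
    case False
    then have "c > 0" using psd[of y] by (simp add: c_def)
    then have "0 \<le> c * (a - 2 * (b / c) * b + (b / c)\<^sup>2 * c)" using poly[of "b/c"] by simp
    also have "\<dots> = a * c - b\<^sup>2"
      using False by (simp add: field_simps power2_eq_square)
    finally show ?thesis by simp
  qed
  then show ?thesis by (simp add: a_def b_def c_def)
qed

text \<open>
  By compactness the quadratic form has a minimum \<open>l\<close> on the unit sphere, attained at some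
  \<open>v\<close>. Then \<open>A - l\<close> is positive semidefinite and its form vanishes at \<open>v\<close>, so the
  Cauchy--Schwarz inequality gives \<open>(A - l) v = 0\<close>.
\<close>

lemma symmetric_rayleigh_minimum:
  fixes A :: "real^'n^'n"
  assumes sym: "transpose A = A"
  obtains l where "eigenvalue A l" and "\<And>x. l * (norm x)\<^sup>2 \<le> x \<bullet> (A *v x)"
proof -
  have "(sphere 0 1 :: (real^'n) set) \<noteq> {}" by simp
  moreover have "continuous_on (sphere 0 1) (\<lambda>x. x \<bullet> (A *v x))"
    by (intro continuous_intros linear_continuous_on matrix_vector_mul_bounded_linear)
  ultimately obtain v where v: "norm v = 1"
    and min: "\<And>x. norm x = 1 \<Longrightarrow> v \<bullet> (A *v v) \<le> x \<bullet> (A *v x)"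
    using continuous_attains_inf[of "sphere 0 1 :: (real^'n) set" "\<lambda>x. x \<bullet> (A *v x)"]
    by auto
  define l where "l = v \<bullet> (A *v v)"
  define B where "B = A - l *\<^sub>R mat 1"
  have B: "B *v x = A *v x - l *\<^sub>R x" for x
    by (simp add: B_def matrix_vector_mult_diff_rdistrib scaleR_matrix_vector_assoc[symmetric])
  have bound: "l * (norm x)\<^sup>2 \<le> x \<bullet> (A *v x)" for x
  proof (cases "x = 0")
    case False
    have "l \<le> (x /\<^sub>R norm x) \<bullet> (A *v (x /\<^sub>R norm x))"
      unfolding l_def by (rule min) (use False in simp)
    also have "\<dots> = x \<bullet> (A *v x) / (norm x)\<^sup>2"
      by (simp add: matrix_vector_mult_scaleR power2_eq_square divide_simps)
    finally show ?thesis using False by (simp add: field_simps)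
  qed simp
  have symB: "transpose B = B"
    using sym by (simp add: B_def transpose_def mat_def vec_eq_iff)
  have psd: "0 \<le> x \<bullet> (B *v x)" for x
    using bound[of x] by (simp add: B inner_diff_right power2_norm_eq_inner)
  have zero: "v \<bullet> (B *v v) = 0"
    using v by (simp add: B inner_diff_right l_def power2_norm_eq_inner[symmetric])
  have "((B *v v) \<bullet> (B *v v))\<^sup>2 \<le> 0"
    using psd_cauchy_schwarz[OF symB psd, of "B *v v" v] zero by simp
  then have "A *v v = l *\<^sub>R v" by (simp add: B)
  then have "eigenvalue A l" using v by (auto simp: eigenvalue_def intro!: exI[of _ v])
  with bound show ?thesis using that by blast
qed

lemma smallest_eigenvalue_le_rayleigh:
  assumes "transpose A = A" and "is_smallest_eigenvalue A m"
  shows "m * (norm x)\<^sup>2 \<le> x \<bullet> (A *v x)"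
proof -
  obtain l where "eigenvalue A l" and l: "l * (norm x)\<^sup>2 \<le> x \<bullet> (A *v x)"
    using symmetric_rayleigh_minimum[OF assms(1)] by metis
  then have "m \<le> l" using assms(2) by (simp add: is_smallest_eigenvalue_def)
  then show ?thesis using l by (meson mult_right_mono order_trans zero_le_power2)
qed

lemma rayleigh_le_largest_eigenvalue:
  assumes "transpose A = A" and "is_largest_eigenvalue A l"
  shows "x \<bullet> (A *v x) \<le> l * (norm x)\<^sup>2"
proof -
  have neg: "(- A) *v v = - (A *v v)" for v
    by (simp add: matrix_vector_mult_def vec_eq_iff sum_negf)
  have "eigenvalue (- A) k \<longleftrightarrow> eigenvalue A (- k)" for k
    unfolding eigenvalue_def neg by (metis add.inverse_inverse scaleR_minus_left)
  then have "is_smallest_eigenvalue (- A) (- l)"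
    using assms(2) by (auto simp: is_smallest_eigenvalue_def is_largest_eigenvalue_def
        minus_le_iff[symmetric])
  moreover have "transpose (- A) = - A"
    using assms(1) by (simp add: transpose_def vec_eq_iff)
  ultimately show ?thesis
    using smallest_eigenvalue_le_rayleigh[of "- A" "- l" x] by (simp add: neg)
qed

text \<open>
  The minimum of the form on the unit sphere is an eigenvalue, and positive definiteness makes it
  positive.
\<close>

lemma sym_pos_def_coercive:
  assumes "sym_pos_def A"
  obtains c where "c > 0" and "\<And>x. c * (norm x)\<^sup>2 \<le> x \<bullet> (A *v x)"
proof -
  from assms have sym: "transpose A = A" and pos: "\<And>v. v \<noteq> 0 \<Longrightarrow> v \<bullet> (A *v v) > 0"
    by (auto simp: sym_pos_def_def)
  obtain l where l: "eigenvalue A l" "\<And>x. l * (norm x)\<^sup>2 \<le> x \<bullet> (A *v x)"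
    using symmetric_rayleigh_minimum[OF sym] by metis
  from l(1) obtain v where "v \<noteq> 0" "A *v v = l *\<^sub>R v" by (auto simp: eigenvalue_def)
  with pos[of v] have "l * (v \<bullet> v) > 0" by simp
  then have "l > 0" using \<open>v \<noteq> 0\<close> by (intro zero_less_mult_pos2[of l "v \<bullet> v"]) auto
  with l(2) show ?thesis using that by blast
qed

lemma sym_pos_def_invertible:
  assumes "sym_pos_def A"
  shows "invertible A"
proof -
  have "x = 0" if "A *v x = 0" for x
    using assms that unfolding sym_pos_def_def by (metis inner_zero_right less_irrefl)
  then show ?thesis
    unfolding invertible_left_inverse matrix_left_invertible_ker by blast
qed

lemma matrix_mult_matrix_inv:
  assumes "invertible A"
  shows "A ** matrix_inv A = mat 1"
  using someI_ex[OF assms[unfolded invertible_def]] by (simp add: matrix_inv_def)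

lemma sym_pos_def_mult_inv:
  assumes "sym_pos_def A"
  shows "A *v (matrix_inv A *v x) = x"
  using matrix_mult_matrix_inv[OF sym_pos_def_invertible[OF assms]]
  by (simp add: matrix_vector_mul_assoc)

lemma sym_pos_def_matrix_inv:
  fixes A :: "real^'n^'n"
  assumes "sym_pos_def A"
  shows "sym_pos_def (matrix_inv A)"
proof -
  let ?W = "matrix_inv A"
  note AW = sym_pos_def_mult_inv[OF assms]
  from assms have sym: "transpose A = A" and pos: "\<And>v. v \<noteq> 0 \<Longrightarrow> v \<bullet> (A *v v) > 0"
    by (auto simp: sym_pos_def_def)
  have "transpose ?W = ?W"
    using sym matrix_mult_matrix_inv[OF sym_pos_def_invertible[OF assms]]
    by (metis matrix_mul_assoc matrix_mul_lid matrix_mul_rid matrix_transpose_mul transpose_mat)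
  moreover have "v \<bullet> (?W *v v) > 0" if "v \<noteq> 0" for v
  proof -
    have "?W *v v \<noteq> 0" using that AW[of v] by auto
    from pos[OF this] show ?thesis by (simp add: AW inner_commute)
  qed
  ultimately show ?thesis by (simp add: sym_pos_def_def)
qed

text \<open>
  With \<open>y = A\<^sup>-\<^sup>1 x\<close> the lower bound on \<open>A\<close> reads \<open>m |y|\<^sup>2 \<le> y \<bullet> x\<close>, which
  gives \<open>|y| \<le> |x| / m\<close> without diagonalizing \<open>A\<close>.
\<close>

lemma matrix_inv_form_le:
  assumes "sym_pos_def A" and "m > 0" and low: "\<And>x. m * (norm x)\<^sup>2 \<le> x \<bullet> (A *v x)"
  shows "x \<bullet> (matrix_inv A *v x) \<le> (norm x)\<^sup>2 / m"
proof -
  define y where "y = matrix_inv A *v x"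
  have "m * (norm y)\<^sup>2 \<le> y \<bullet> x"
    using low[of y] by (simp add: y_def sym_pos_def_mult_inv[OF assms(1)])
  also have "\<dots> \<le> norm y * norm x" by (rule norm_cauchy_schwarz)
  finally have *: "m * (norm y)\<^sup>2 \<le> norm y * norm x" .
  have "norm y \<le> norm x / m"
  proof (cases "norm y = 0")
    case False
    then have "norm y > 0" by simp
    with * have "m * norm y \<le> norm x" by (simp add: power2_eq_square)
    then show ?thesis using \<open>m > 0\<close> by (simp add: field_simps)
  qed (use \<open>m > 0\<close> in simp)
  have "x \<bullet> y \<le> norm x * norm y" by (rule norm_cauchy_schwarz)
  also have "\<dots> \<le> norm x * (norm x / m)" 
    by (rule mult_left_mono[OF \<open>norm y \<le> norm x / m\<close>]) simp
  finally show ?thesis by (simp add: y_def power2_eq_square)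
qed

text \<open>
  This is \<open>A\<^sup>2 \<le> l A\<close> for \<open>0 \<le> A \<le> l\<close>, obtained without a functional calculus by the
  Cauchy--Schwarz inequality for the form of \<open>A\<close> applied to \<open>A x\<close> and \<open>x\<close>.
\<close>

lemma norm_mult_square_le:
  fixes A :: "real^'n^'n"
  assumes sym: "transpose A = A" and psd: "\<And>v. 0 \<le> v \<bullet> (A *v v)"
    and up: "\<And>x. x \<bullet> (A *v x) \<le> l * (norm x)\<^sup>2"
  shows "(norm (A *v x))\<^sup>2 \<le> l * (x \<bullet> (A *v x))"
proof (cases "A *v x = 0")
  case False
  let ?y = "A *v x"
  have "((norm ?y)\<^sup>2)\<^sup>2 \<le> (?y \<bullet> (A *v ?y)) * (x \<bullet> (A *v x))"
    using psd_cauchy_schwarz[OF sym psd, of ?y x] by (simp add: power2_norm_eq_inner)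
  also have "\<dots> \<le> (l * (norm ?y)\<^sup>2) * (x \<bullet> (A *v x))"
    by (intro mult_right_mono up psd)
  finally have "(norm ?y)\<^sup>2 * (norm ?y)\<^sup>2 \<le> (l * (x \<bullet> (A *v x))) * (norm ?y)\<^sup>2"
    by (simp add: power2_eq_square mult_ac)
  moreover have "(norm ?y)\<^sup>2 > 0" using False by simp
  ultimately show ?thesis by (simp only: mult_le_cancel_right_pos)
qed simp

text \<open>
  Exchanges a product of two momenta for the form at their mean, which will be controlled, and
  the form at their difference, which is a momentum jump.
\<close>

lemma polarized_product:
  fixes W :: "real^'n^'n"
  assumes "transpose W = W"
  shows "u \<bullet> (W *v v) = ((1/2) *\<^sub>R (u + v)) \<bullet> (W *v ((1/2) *\<^sub>R (u + v)))
          - (1/4) * ((v - u) \<bullet> (W *v (v - u)))"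
  using symmetric_matrix_inner[OF assms, of u v]
  by (simp add: matrix_vector_right_distrib matrix_vector_mult_diff_distrib inner_commute
      matrix_vector_mult_scaleR inner_add_left inner_add_right inner_diff_left inner_diff_right field_simps)

text \<open>
  For \<open>y = 0\<close> the right-hand side is \<open>1 - th\<close> times the form at \<open>x\<close>. Half of this is given up to
  absorb the cross term between \<open>x\<close> and \<open>y\<close> by Young's inequality; what remains is a multiple
  of the form at \<open>y\<close>.
\<close>

lemma perturbed_form_lower_bound:
  fixes A :: "real^'n^'n"
  assumes sym: "transpose A = A" and psd: "\<And>v. 0 \<le> v \<bullet> (A *v v)"
    and th: "0 \<le> th" "th < 1"
  shows "(1 - th) / 2 * (x \<bullet> (A *v x)) - 2 / (1 - th) * (y \<bullet> (A *v y))
     \<le> x \<bullet> (A *v x) - th * ((x - y) \<bullet> (A *v (x - y)))"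
proof -
  define g where "g = 1 - th"
  have g: "g > 0" "g \<le> 1" "th = 1 - g" using th by (simp_all add: g_def)
  define a b c where "a = x \<bullet> (A *v x)" and "b = x \<bullet> (A *v y)" and "c = y \<bullet> (A *v y)"
  have "c \<ge> 0" using psd by (simp add: c_def)
  have "y \<bullet> (A *v x) = b"
    using symmetric_matrix_inner[OF sym, of y x] by (simp add: b_def inner_commute)
  then have d: "(x - y) \<bullet> (A *v (x - y)) = a - 2 * b + c"
    by (simp add: a_def b_def c_def matrix_vector_mult_diff_distrib inner_diff_left
        inner_diff_right)
  \<comment> \<open>Young's inequality for the cross term \<open>2 th b\<close> with exactly half of \<open>g a\<close> as budget:
      this expansion is \<open>2 g\<close> times \<open>g a / 2 + 2 th b + 2 th\<^sup>2 c / g\<close>.\<close>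
  have sq: "(g *\<^sub>R x + (2 * th) *\<^sub>R y) \<bullet> (A *v (g *\<^sub>R x + (2 * th) *\<^sub>R y)) =
      g\<^sup>2 * a + 4 * g * th * b + 4 * th\<^sup>2 * c"
    using \<open>y \<bullet> (A *v x) = b\<close>
    by (simp add: a_def b_def c_def matrix_vector_right_distrib inner_add_left
        inner_add_right matrix_vector_mult_scaleR power2_eq_square algebra_simps)
  then have "0 \<le> g\<^sup>2 * a + 4 * g * th * b + 4 * th\<^sup>2 * c" using psd by metis
  moreover have "(2 * th\<^sup>2 + g * th) * c \<le> 2 * c"
  proof (rule mult_right_mono)
    show "2 * th\<^sup>2 + g * th \<le> 2"
      using power_le_one[of th 2] th by (simp add: g_def power2_eq_square algebra_simps)
  qed fact
  ultimately have "0 \<le> g * (g / 2 * a + 2 * th * b - th * c) + 2 * c"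
    by (simp add: power2_eq_square algebra_simps)
  then have "0 \<le> (g * (g / 2 * a + 2 * th * b - th * c) + 2 * c) / g" using g by simp
  also have "\<dots> = g / 2 * a + 2 * th * b - th * c + 2 / g * c"
    using g(1) by (simp add: field_simps)
  finally show ?thesis
    unfolding d a_def[symmetric] c_def[symmetric] g_def[symmetric]
    by (simp add: g(3) algebra_simps)
qed

section \<open>Gradient and Hessian of a quadratic potential\<close>

lemma gradient_eqI:
  assumes "GDERIV V x :> g"
  shows "gradient V x = g"
  unfolding gradient_def
proof (rule the_equality)
  fix g' assume "GDERIV V x :> g'"
  then have "(\<lambda>k. k \<bullet> g') = (\<lambda>k. k \<bullet> g)"
    using assms unfolding gderiv_def by (rule has_derivative_unique)
  then show "g' = g" by (metis vector_eq_ldot)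
qed (rule assms)

lemma gradient_quadratic:
  fixes V :: "real^'n \<Rightarrow> real"
  assumes "\<And>x. V x = x \<bullet> (A *v x) + b \<bullet> x + c"
  shows "gradient V x = (A + transpose A) *v x + b"
proof (rule gradient_eqI)
  have V: "V = (\<lambda>x. x \<bullet> (A *v x) + b \<bullet> x + c)" using assms by blast
  have "(V has_derivative (\<lambda>k. x \<bullet> (A *v k) + k \<bullet> (A *v x) + b \<bullet> k)) (at x)"
    unfolding V
    by (auto intro!: derivative_eq_intros
        bounded_linear_imp_has_derivative matrix_vector_mul_bounded_linear)
  moreover have "x \<bullet> (A *v k) + k \<bullet> (A *v x) + b \<bullet> k = k \<bullet> ((A + transpose A) *v x + b)" for k
    by (simp add: dot_lmul_matrix[symmetric] transpose_matrix_vector inner_commute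
        matrix_vector_mult_add_rdistrib inner_add_left inner_add_right)
  ultimately show "GDERIV V x :> (A + transpose A) *v x + b"
    unfolding gderiv_def by simp
qed

lemma gradient_eq_hessian_mult:
  fixes V :: "real^'n \<Rightarrow> real"
  assumes "quadratic V" and "gradient V 0 = 0" and "\<And>x. hessian V x = H"
  shows "gradient V x = H *v x"
proof -
  obtain A b c where "\<And>x. V x = x \<bullet> (A *v x) + b \<bullet> x + c"
    using assms(1) by (auto simp: quadratic_def)
  then have grad: "gradient V = (\<lambda>x. (A + transpose A) *v x + b)"
    using gradient_quadratic by blast
  then have "b = 0" using assms(2) by simp
  with grad have lin: "gradient V = (\<lambda>x. (A + transpose A) *v x)" by simp
  have "(gradient V has_derivative gradient V) (at 0)"
    unfolding lin by (intro bounded_linear_imp_has_derivative matrix_vector_mul_bounded_linear)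
  then have "hessian V 0 = matrix (gradient V)"
    unfolding hessian_def jacobian_def by (simp add: frechet_derivative_at[symmetric])
  then have "H = A + transpose A"
    unfolding lin assms(3) by simp
  then show ?thesis by (simp add: lin)
qed

section \<open>Jumps and energy of the scheme\<close>

lemma integral_affine:
  fixes a b :: "'a::euclidean_space"
  assumes "s \<le> e"
  shows "integral {s..e} (\<lambda>r. a + (r - s) *\<^sub>R b) = (e - s) *\<^sub>R a + ((e - s)\<^sup>2 / 2) *\<^sub>R b"
proof -
  let ?F = "\<lambda>r. (r - s) *\<^sub>R a + ((r - s)\<^sup>2 / 2) *\<^sub>R b"
  have "(?F has_vector_derivative (a + (r - s) *\<^sub>R b)) (at r within {s..e})" for r
  proof -
    have "((\<lambda>r. r - s) has_real_derivative 1) (at r within {s..e})"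
      and "((\<lambda>r. (r - s)\<^sup>2 / 2) has_real_derivative (r - s)) (at r within {s..e})"
      by (auto intro!: derivative_eq_intros)
    from has_vector_derivative_add[OF
        has_vector_derivative_scaleR[OF this(1) has_vector_derivative_const]
        has_vector_derivative_scaleR[OF this(2) has_vector_derivative_const]]
    show ?thesis by simp
  qed
  then have "((\<lambda>r. a + (r - s) *\<^sub>R b) has_integral (?F e - ?F s)) {s..e}"
    by (intro fundamental_theorem_of_calculus[OF assms])
  then show ?thesis by (simp add: integral_unique)
qed

text \<open>
  The linear force is affine in time along a free flight, so the trapezoidal rule is exact.
\<close>

lemma integral_force_eq_trapezoid:
  fixes H :: "real^'n^'n" and x p :: "real^'n"
  assumes "s \<le> e"
  shows "integral {s..e} (\<lambda>r. H *v free_flight M s x p r) =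
           ((e - s) / 2) *\<^sub>R (H *v (x + free_flight M s x p e))"
proof -
  have "(\<lambda>r. H *v free_flight M s x p r) =
      (\<lambda>r. H *v x + (r - s) *\<^sub>R (H *v (matrix_inv M *v p)))"
    by (simp add: free_flight_def matrix_vector_right_distrib matrix_vector_mult_scaleR)
  then have "integral {s..e} (\<lambda>r. H *v free_flight M s x p r) =
      (e - s) *\<^sub>R (H *v x) + ((e - s)\<^sup>2 / 2) *\<^sub>R (H *v (matrix_inv M *v p))"
    using integral_affine[OF assms] by simp
  also have "\<dots> = ((e - s) / 2) *\<^sub>R (H *v (x + free_flight M s x p e))"
  proof -
    have "H *v (x + free_flight M s x p e) =
        2 *\<^sub>R (H *v x) + (e - s) *\<^sub>R (H *v (matrix_inv M *v p))"
      by (simp only: free_flight_def matrix_vector_right_distrib matrix_vector_mult_scaleR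
          scaleR_2 add.assoc)
    then show ?thesis by (simp add: scaleR_add_right power2_eq_square)
  qed
  finally show ?thesis .
qed

lemma scheme_force_sum:
  assumes sch: "scheme M V h t q0 p0 q p J"
    and grad: "\<And>x. gradient V x = H *v x" and h: "h > 0" "\<And>n. t (Suc n) - t n = h"
  shows "J (Suc n) + J n = - (h *\<^sub>R (H *v (q n + q (Suc n))))"
proof -
  have le: "t n \<le> t (Suc n)" using h(1) h(2)[of n] by linarith
  have ff: "free_flight M (t n) (q n) (p (Suc n)) (t (Suc n)) = q (Suc n)"
    using sch by (simp add: free_flight_def scheme_def h(2))
  have "(1/2) *\<^sub>R (J (Suc n) + J n) = - ((h / 2) *\<^sub>R (H *v (q n + q (Suc n))))"
    using integral_force_eq_trapezoid[OF le, of H M "q n" "p (Suc n)"] sch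
    unfolding scheme_def grad ff h(2) by metis
  then have "2 *\<^sub>R ((1/2) *\<^sub>R (J (Suc n) + J n)) = 2 *\<^sub>R (- ((h / 2) *\<^sub>R (H *v (q n + q (Suc n)))))"
    by simp
  then show ?thesis by simp
qed

text \<open>
  The quantity \<open>J\<^sub>n + h H q\<^sub>n\<close> only changes sign from one step to the next, so it equals
  \<open>(-1)\<^sup>n h H q\<^sub>0\<close>. The alternating term is the trace of the initialization
  \<open>J\<^sub>0 = 0\<close>; without it the scheme would be the leapfrog method.
\<close>

lemma scheme_jump:
  assumes sch: "scheme M V h t q0 p0 q p J"
    and grad: "\<And>x. gradient V x = H *v x" and h: "h > 0" "\<And>n. t (Suc n) - t n = h"
  shows "J n = - (h *\<^sub>R (H *v (q n - (-1)^n *\<^sub>R q 0)))"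
proof (induction n)
  case 0
  then show ?case using sch by (simp add: scheme_def)
next
  case (Suc n)
  have "J (Suc n) = - (h *\<^sub>R (H *v (q n + q (Suc n)))) - J n"
    using scheme_force_sum[OF assms, of n] by (simp add: algebra_simps)
  then show ?case
    unfolding Suc
    by (simp add: matrix_vector_right_distrib matrix_vector_mult_diff_distrib
        matrix_vector_mult_scaleR algebra_simps)
qed

text \<open>
  Both increments are the same number with opposite signs. The potential part changes by
  \<open>(q\<^sub>n\<^sub>+\<^sub>1 - q\<^sub>n) \<bullet> H (q\<^sub>n + q\<^sub>n\<^sub>+\<^sub>1)\<close>, where the first factor is
  \<open>h W p\<^sub>n\<^sub>+\<^sub>1\<close>; the kinetic part changes by
  \<open>p\<^sub>n\<^sub>+\<^sub>1 \<bullet> W (p\<^sub>n\<^sub>+\<^sub>2 - p\<^sub>n)\<close>, where the bracket is the sum of two consecutive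
  jumps.
\<close>

lemma scheme_energy_conserved:
  assumes sch: "scheme M V h t q0 p0 q p J"
    and grad: "\<And>x. gradient V x = H *v x" and h: "h > 0" "\<And>n. t (Suc n) - t n = h"
    and symH: "transpose H = H" and symW: "transpose (matrix_inv M) = matrix_inv M"
  shows "q n \<bullet> (H *v q n) + p n \<bullet> (matrix_inv M *v p (Suc n)) =
         q 0 \<bullet> (H *v q 0) + p 0 \<bullet> (matrix_inv M *v p (Suc 0))"
proof (induction n)
  case (Suc n)
  let ?W = "matrix_inv M"
  define x y P where "x = q n" and "y = q (Suc n)" and "P = p (Suc n)"
  have "p (Suc (Suc n)) = p n + (J (Suc n) + J n)" "P = p n + J n"
    using sch by (simp_all add: scheme_def P_def)
  then have dp: "p (Suc (Suc n)) = p n - h *\<^sub>R (H *v (x + y))"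
    using scheme_force_sum[OF sch grad h, of n] by (simp add: x_def y_def)
  have dq: "h *\<^sub>R (?W *v P) = y - x"
    using sch by (simp add: scheme_def P_def x_def y_def)
  have "P \<bullet> (?W *v p (Suc (Suc n))) = (?W *v P) \<bullet> p (Suc (Suc n))"
    by (rule symmetric_matrix_inner[OF symW])
  also have "\<dots> = p n \<bullet> (?W *v P) - (h *\<^sub>R (?W *v P)) \<bullet> (H *v (x + y))"
    by (simp add: dp inner_diff_right inner_commute)
  also have "(h *\<^sub>R (?W *v P)) \<bullet> (H *v (x + y)) = y \<bullet> (H *v y) - x \<bullet> (H *v x)"
    using symmetric_matrix_inner[OF symH, of x y]
    by (simp add: dq matrix_vector_right_distrib inner_diff_left inner_diff_right
        inner_add_right inner_commute)
  finally show ?case using Suc by (simp add: x_def y_def P_def)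
qed simp

section \<open>Stability\<close>

lemma norm_le_of_square_le:
  fixes x :: "'a::real_normed_vector"
  assumes "c > 0" and "c * (norm x)\<^sup>2 \<le> R * D\<^sup>2" and "D \<ge> 0"
  shows "norm x \<le> sqrt (R / c) * D"
proof -
  have "(norm x)\<^sup>2 \<le> R / c * D\<^sup>2" using assms(1,2) by (simp add: field_simps)
  then have "norm x \<le> sqrt (R / c * D\<^sup>2)" by (rule real_le_rsqrt)
  then show ?thesis using assms(3) by (simp only: real_sqrt_mult real_sqrt_abs abs_of_nonneg)
qed

theorem proposition6:
  fixes M H :: "real^'n^'n" and V :: "real^'n \<Rightarrow> real"
    and h lam mu :: real and t :: "nat \<Rightarrow> real"
  assumes "sym_pos_def M"
    and "quadratic V"
    and "V 0 = 0" and "gradient V 0 = 0"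
    and "\<And>x. hessian V x = H"
    and "sym_pos_def H"
    and "is_largest_eigenvalue H lam"
    and "is_smallest_eigenvalue M mu" and "mu > 0"
    and "h > 0" and "\<And>n. t (Suc n) - t n = h"
    and "h < 2 * sqrt (mu / lam)"
  shows "linearly_stable M V h t"
proof -
  define W where "W = matrix_inv M"
  note grad = gradient_eq_hessian_mult[OF assms(2,4,5)]
  have posW: "sym_pos_def W" unfolding W_def by (rule sym_pos_def_matrix_inv[OF assms(1)])
  have symM: "transpose M = M" and symH: "transpose H = H" and symW: "transpose W = W"
    using assms(1,6) posW by (auto simp: sym_pos_def_def)
  obtain cH where cH: "cH > 0" "\<And>x. cH * (norm x)\<^sup>2 \<le> x \<bullet> (H *v x)"
    using sym_pos_def_coercive[OF assms(6)] by metis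
  obtain cW where cW: "cW > 0" "\<And>x. cW * (norm x)\<^sup>2 \<le> x \<bullet> (W *v x)"
    using sym_pos_def_coercive[OF posW] by metis
  have psdH: "0 \<le> x \<bullet> (H *v x)" for x
    using cH(1) by (intro order_trans[OF _ cH(2)]) simp

  \<comment> \<open>If \<open>lam\<close> were not positive, the bound on \<open>h\<close> would not be positive either
      (for \<open>lam = 0\<close> because division by zero gives zero).\<close>
  have "lam > 0"
  proof (rule ccontr)
    assume "\<not> lam > 0"
    then have "mu / lam \<le> 0" using assms(9) by (simp add: divide_le_0_iff)
    then have "sqrt (mu / lam) \<le> 0" by simp
    then show False using assms(10,12) by linarith
  qed
  define th where "th = h\<^sup>2 * lam / (4 * mu)"
  have th0: "0 \<le> th" using \<open>lam > 0\<close> assms(9) by (simp add: th_def)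
  have "h\<^sup>2 < (2 * sqrt (mu / lam))\<^sup>2"
    using assms(10,12) by (intro power_strict_mono) auto
  also have "\<dots> = 4 * (mu / lam)"
    using \<open>lam > 0\<close> assms(9) by (simp add: power_mult_distrib)
  finally have th1: "th < 1"
    using \<open>lam > 0\<close> assms(9) by (simp add: th_def field_simps)

  \<comment> \<open>With \<open>z = q\<^sub>n - y\<close> the left-hand side is the subtracted term \<open>J\<^sub>n \<bullet> W J\<^sub>n / 4\<close> of the energy.\<close>
  have kick: "h\<^sup>2 / 4 * ((H *v z) \<bullet> (W *v (H *v z))) \<le> th * (z \<bullet> (H *v z))" for z
  proof -
    have "(H *v z) \<bullet> (W *v (H *v z)) \<le> (norm (H *v z))\<^sup>2 / mu"
      unfolding W_def by (rule matrix_inv_form_le[OF assms(1,9)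
          smallest_eigenvalue_le_rayleigh[OF symM assms(8)]])
    also have "\<dots> \<le> lam * (z \<bullet> (H *v z)) / mu"
      using norm_mult_square_le[OF symH psdH rayleigh_le_largest_eigenvalue[OF symH assms(7)]]
        assms(9) by (simp add: divide_right_mono)
    finally have "h\<^sup>2 / 4 * ((H *v z) \<bullet> (W *v (H *v z))) \<le> h\<^sup>2 / 4 * (lam * (z \<bullet> (H *v z)) / mu)"
      by (rule mult_left_mono) simp
    then show ?thesis by (simp add: th_def)
  qed

  obtain KH where KH: "KH > 0" "\<And>x. norm (H *v x) \<le> norm x * KH"
    using bounded_linear.pos_bounded[OF matrix_vector_mul_bounded_linear[of H]] by metis
  obtain KW where KW: "KW > 0" "\<And>x. norm (W *v x) \<le> norm x * KW"
    using bounded_linear.pos_bounded[OF matrix_vector_mul_bounded_linear[of W]] by metis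
  \<comment> \<open>\<open>R\<close> collects the initial energy and the error term at \<open>y\<close>; \<open>k1\<close>, \<open>k2\<close> bound the position
      and the mean momentum, and the last summand of \<open>C\<close> bounds the jump.\<close>
  define R where "R = KH + KW + 2 / (1 - th) * KH"
  define k1 k2 where "k1 = sqrt (R / ((1 - th) / 2 * cH))" and "k2 = sqrt (R / cW)"
  define C where "C = k1 + 2 * k2 + h * KH * (k1 + 1)"
  show ?thesis
    unfolding linearly_stable_def
  proof (intro exI[of _ C] allI impI)
    fix q0 p0 q p J n
    assume sch: "scheme M V h t q0 p0 q p J"
    define D where "D = norm (q 0, p 0, p (Suc 0))"
    define s where "s = (-1 :: real) ^ n"
    define m where "m = (1/2) *\<^sub>R (p n + p (Suc n))"
    define y where "y = s *\<^sub>R q 0"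
    have s: "s * s = 1" "\<bar>s\<bar> = 1" by (simp_all add: s_def flip: power_mult_distrib)
    have D0: "D \<ge> 0" "norm (q 0) \<le> D" "norm (p 0) \<le> D" "norm (p (Suc 0)) \<le> D"
      unfolding D_def
      by (auto intro: norm_fst_le order_trans[OF norm_fst_le norm_snd_le]
          order_trans[OF norm_snd_le norm_snd_le])
    have jump: "J n = - (h *\<^sub>R (H *v (q n - y)))"
      using scheme_jump[OF sch grad assms(10,11)] by (simp add: y_def s_def)
    have pn: "p (Suc n) = p n + J n" using sch by (simp add: scheme_def)

    have q0H: "q 0 \<bullet> (H *v q 0) \<le> KH * D\<^sup>2"
    proof -
      have "q 0 \<bullet> (H *v q 0) \<le> norm (q 0) * norm (H *v q 0)" by (rule norm_cauchy_schwarz)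
      also have "\<dots> \<le> D * (D * KH)"
        using D0 KH by (intro mult_mono order_trans[OF KH(2)]) auto
      finally show ?thesis by (simp add: power2_eq_square mult_ac)
    qed
    have p0W: "p 0 \<bullet> (W *v p (Suc 0)) \<le> KW * D\<^sup>2"
    proof -
      have "p 0 \<bullet> (W *v p (Suc 0)) \<le> norm (p 0) * norm (W *v p (Suc 0))"
        by (rule norm_cauchy_schwarz)
      also have "\<dots> \<le> D * (D * KW)"
        using D0 KW by (intro mult_mono order_trans[OF KW(2)]) auto
      finally show ?thesis by (simp add: power2_eq_square mult_ac)
    qed
    have "(1 - th) / 2 * (q n \<bullet> (H *v q n)) - 2 / (1 - th) * (y \<bullet> (H *v y)) + m \<bullet> (W *v m)
        \<le> q n \<bullet> (H *v q n) - th * ((q n - y) \<bullet> (H *v (q n - y))) + m \<bullet> (W *v m)"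
      using perturbed_form_lower_bound[OF symH psdH th0 th1, of "q n" y] by simp
    also have "\<dots> \<le> q n \<bullet> (H *v q n) + p n \<bullet> (W *v p (Suc n))"
      unfolding polarized_product[OF symW, of "p n" "p (Suc n)"] m_def[symmetric]
      using kick[of "q n - y"]
      by (simp add: pn jump matrix_vector_mult_scaleR power2_eq_square linear_neg)
    also have "\<dots> = q 0 \<bullet> (H *v q 0) + p 0 \<bullet> (W *v p (Suc 0))"
      using scheme_energy_conserved[OF sch grad assms(10,11) symH symW[unfolded W_def]]
      by (simp add: W_def)
    finally have "(1 - th) / 2 * (q n \<bullet> (H *v q n)) + m \<bullet> (W *v m)
        \<le> KH * D\<^sup>2 + KW * D\<^sup>2 + 2 / (1 - th) * (y \<bullet> (H *v y))"
      using q0H p0W by linarith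
    also have "y \<bullet> (H *v y) = q 0 \<bullet> (H *v q 0)"
      using s(1) by (simp add: y_def matrix_vector_mult_scaleR flip: mult.assoc)
    also have "KH * D\<^sup>2 + KW * D\<^sup>2 + 2 / (1 - th) * (q 0 \<bullet> (H *v q 0)) \<le> R * D\<^sup>2"
      unfolding R_def distrib_right mult.assoc using q0H th1
      by (intro add_left_mono mult_left_mono) auto
    finally have main: "(1 - th) / 2 * (q n \<bullet> (H *v q n)) + m \<bullet> (W *v m) \<le> R * D\<^sup>2" .

    have "(1 - th) / 2 * (cH * (norm (q n))\<^sup>2) \<le> (1 - th) / 2 * (q n \<bullet> (H *v q n))"
      using th1 by (intro mult_left_mono cH(2)) simp
    moreover have "0 \<le> (1 - th) / 2 * (q n \<bullet> (H *v q n))"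
      using th1 psdH by simp
    moreover have "0 \<le> m \<bullet> (W *v m)"
      using cW(1) by (intro order_trans[OF _ cW(2)]) simp
    ultimately have "((1 - th) / 2 * cH) * (norm (q n))\<^sup>2 \<le> R * D\<^sup>2"
      and "cW * (norm m)\<^sup>2 \<le> R * D\<^sup>2"
      using main cW(2)[of m] by (simp_all only: mult.assoc)
    then have nq: "norm (q n) \<le> k1 * D" and nm: "norm m \<le> k2 * D"
      unfolding k1_def k2_def using cH(1) cW(1) th1 D0(1)
      by (auto intro!: norm_le_of_square_le)

    have "norm (q n - y) \<le> (k1 + 1) * D"
      using norm_triangle_ineq4[of "q n" y] nq D0(2) s(2) by (simp add: y_def distrib_right)
    then have "norm (q n - y) * KH \<le> ((k1 + 1) * D) * KH"
      using KH(1) by (intro mult_right_mono) auto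
    with KH(2)[of "q n - y"] have "norm (H *v (q n - y)) \<le> ((k1 + 1) * D) * KH" by linarith
    then have "h * norm (H *v (q n - y)) \<le> h * (((k1 + 1) * D) * KH)"
      using assms(10) by (intro mult_left_mono) auto
    then have nJ: "norm (J n) \<le> h * KH * (k1 + 1) * D"
      using assms(10) by (simp add: jump mult_ac)

    have "p n = m - (1/2) *\<^sub>R J n" "p (Suc n) = m + (1/2) *\<^sub>R J n"
      unfolding m_def pn by (simp_all add: scaleR_add_right flip: scaleR_add_left)
    then have "norm (p n) \<le> norm m + norm (J n) / 2" "norm (p (Suc n)) \<le> norm m + norm (J n) / 2"
      using norm_triangle_ineq4[of m "(1/2) *\<^sub>R J n"] norm_triangle_ineq[of m "(1/2) *\<^sub>R J n"]
      by simp_all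
    moreover have "norm (q n, p n, p (Suc n)) \<le> norm (q n) + (norm (p n) + norm (p (Suc n)))"
      by (intro order_trans[OF norm_Pair_le] add_left_mono norm_Pair_le)
    ultimately have "norm (q n, p n, p (Suc n)) \<le> k1 * D + 2 * (k2 * D) + h * KH * (k1 + 1) * D"
      using nq nm nJ by linarith
    also have "\<dots> = C * D" by (simp add: C_def distrib_right)
    finally show "norm (q n, p n, p (Suc n)) \<le> C * norm (q 0, p 0, p (Suc 0))"
      by (simp only: D_def)
  qed
qed

end
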